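(* Let $(U(t,s))_{t\ge s}$ be an evolution family of bounded linear operators on a real separable Hilbert space $\mathbb{H}$. Fix $t_0\in\mathbb{R}$ and let $(\mu_{t,s})_{t_0\ge t\ge s}$ be Borel probability measures on $\mathbb{H}$ such that $\mu_{t,s}=\mu_{t,r}*(\mu_{r,s}\circ U(t,r)^{-1})$ for all $s\le r\le t\le t_0$, and such that $\mu_{t,s}\Rightarrow\delta_0$ as $s\uparrow t$ (for each fixed $t$) and as $t\downarrow s$ (for each fixed $s$). For $s\le t\le t_0$ set $\tilde\mu_{t,s}=\mu_{t,s}\circ U(t_0,t)^{-1}$. Then: (i) For all $s\le r\le t\le t_0$, $\tilde\mu_{t,s}=\tilde\mu_{t,r}*\tilde\mu_{r,s}$ and $\tilde\mu_{s,s}=\delta_0$; moreover $\tilde\mu_{t,s}\Rightarrow\delta_0$ as $s\uparrow t$ and as $t\downarrow s$. (ii) There is a stochastically continuous $\mathbb{H}$-valued stochastic process $(X_t)_{t\le t_0}$ such that: (a) for all $t\le t_0$, $X_t$ has distribution $\mu_{t_0,t}$; in particular $X_{t_0}=0$ almost surely; (b) for all $n$ and all $t_0\ge t_1>t_2>\cdots>t_n$, the increments $X_{t_j}-X_{t_{j-1}}$, $j=1,\dots,n$, are independent; moreover, for all $s\le t\le t_0$, the increment $X_s-X_t$ has distribution $\tilde\mu_{t,s}$.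
   Context: An evolution family on $\mathbb{H}$ is a family $(U(t,s))_{t\ge s}$, $s,t\in\mathbb{R}$, of bounded linear operators with $U(s,s)=I$, $U(t,r)U(r,s)=U(t,s)$ for $t\ge r\ge s$, and $(t,s)\mapsto U(t,s)x$ continuous on $\{t\ge s\}$ for each $x\in\mathbb{H}$. $\Rightarrow$ denotes weak convergence of probability measures; $\mu\circ T^{-1}$ is the image measure; $*$ is convolution. A process is stochastically continuous if $X_{t'}\to X_t$ in probability as $t'\to t$, for every $t$ in its index set. *)

theory Defs
  imports "HOL-Probability.Probability"
begin

definition evolution_family ::
  "(real \<Rightarrow> real \<Rightarrow> 'a::real_normed_vector \<Rightarrow>\<^sub>L 'a) \<Rightarrow> bool" where
  "evolution_family U \<longleftrightarrow>
     (\<forall>s. U s s = id_blinfun) \<and>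
     (\<forall>s r t. s \<le> r \<longrightarrow> r \<le> t \<longrightarrow> U t r o\<^sub>L U r s = U t s) \<and>
     (\<forall>x. continuous_on {(t, s). s \<le> t} (\<lambda>(t, s). blinfun_apply (U t s) x))"

(* The convolution of HOL-Probability requires ordered_euclidean_space, hence finite dimension;
   this is the same formula on a more general type. *)
definition conv_measure ::
  "'a::{topological_space,plus} measure \<Rightarrow> 'a measure \<Rightarrow> 'a measure" where
  "conv_measure M N = distr (M \<Otimes>\<^sub>M N) borel (\<lambda>(x, y). x + y)"

(* weak_conv_m of HOL-Probability covers sequences of measures on the real line only.
   M i (eventually along F) and N are meant to be Borel probability measures. *)
definition weak_conv_along ::
  "('i \<Rightarrow> 'a::topological_space measure) \<Rightarrow> 'a measure \<Rightarrow> 'i filter \<Rightarrow> bool" where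
  "weak_conv_along M N F \<longleftrightarrow>
     (\<forall>f::'a \<Rightarrow> real. continuous_on UNIV f \<longrightarrow> bounded (range f) \<longrightarrow>
        ((\<lambda>i. \<integral>x. f x \<partial>M i) \<longlongrightarrow> (\<integral>x. f x \<partial>N)) F)"

definition tilde_measure ::
  "(real \<Rightarrow> real \<Rightarrow> 'a::real_normed_vector \<Rightarrow>\<^sub>L 'a) \<Rightarrow> real \<Rightarrow>
   (real \<Rightarrow> real \<Rightarrow> 'a measure) \<Rightarrow> real \<Rightarrow> real \<Rightarrow> 'a measure" where
  "tilde_measure U t0 \<mu> t s = distr (\<mu> t s) borel (blinfun_apply (U t0 t))"

(* Meaningful when every X t with t in T is a random variable, so that the events are measurable. *)
definition stochastically_continuous_on ::
  "'w measure \<Rightarrow> real set \<Rightarrow> (real \<Rightarrow> 'w \<Rightarrow> 'a::metric_space) \<Rightarrow> bool" where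
  "stochastically_continuous_on M T X \<longleftrightarrow>
     (\<forall>t\<in>T. \<forall>\<epsilon>>0.
        ((\<lambda>t'. measure M {\<omega> \<in> space M. dist (X t' \<omega>) (X t \<omega>) > \<epsilon>}) \<longlongrightarrow> 0) (at t within T))"

end

theory Submission
  imports Defs
begin

text \<open>
  Pushing everything forward to time \<open>t0\<close> removes the evolution family. Applying \<open>U t0 t\<close> to the skew
  convolution equation and using linearity together with \<open>U t0 t o U t r = U t0 r\<close> turns it into the plain
  hemigroup law for the measures \<open>tilde_measure U t0 \<mu> t s\<close>. Weak convergence to the Dirac measure at zero
  means that the mass outside every ball around zero vanishes
  (\<open>weak_conv_along_return_0_iff_tails\<close>). A linear map of norm at most \<open>C\<close> only changes the radius by
  the factor \<open>C\<close>, so the convergence carries over to the transformed measures. For \<open>t \<down> s\<close> the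
  operator varies and a constant valid for all \<open>t\<close> near \<open>s\<close> is needed; it comes from the strong
  continuity of \<open>U\<close> and the uniform boundedness principle. That \<open>\<mu> t t\<close> is the Dirac measure follows from
  \<open>\<mu> t s = \<mu> t t * \<mu> t s\<close> by letting \<open>s\<close> increase to \<open>t\<close>.
  
  The transformed measures are then the increment laws of a process that starts at zero at time \<open>t0\<close> and runs
  backwards. For a finite set \<open>J\<close> of times, take the product of the laws of the increments between
  neighbouring times and form partial sums. By the hemigroup law these finite-dimensional distributions
  are consistent (\<open>fdd_insert\<close>): deleting a time adds two neighbouring independent increments, that is,
  it convolves their laws. Kolmogorov's extension theorem for Polish spaces gives the process. Its
  increments are coordinates of the product measures, hence independent with the prescribed laws; the
  value at \<open>t\<close> is the increment from \<open>t0\<close>; and stochastic continuity is the tail form of the weak convergence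
  already shown.
\<close>

section \<open>Convolution and convergence to the Dirac measure at zero\<close>

lemma sets_conv_measure [simp, measurable_cong]: "sets (conv_measure M N) = sets borel"
  by (simp add: conv_measure_def)

lemma measurable_plus_pair:
  fixes M N :: "'a::{second_countable_topology,topological_monoid_add} measure"
  assumes [measurable_cong]: "sets M = sets borel" "sets N = sets borel"
  shows "(\<lambda>(x, y). x + y) \<in> borel_measurable (M \<Otimes>\<^sub>M N)"
  by measurable

lemma prob_space_conv_measure:
  fixes M N :: "'a::{second_countable_topology,topological_monoid_add} measure"
  assumes "prob_space M" "prob_space N" "sets M = sets borel" "sets N = sets borel"
  shows "prob_space (conv_measure M N)"
  unfolding conv_measure_def
  by (intro prob_space.prob_space_distr prob_space_pair measurable_plus_pair assms)

lemma nn_integral_conv_measure: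
  fixes M N :: "'a::{second_countable_topology,topological_monoid_add} measure"
  assumes "sigma_finite_measure N" and [measurable_cong]: "sets M = sets borel" "sets N = sets borel"
    and [measurable]: "f \<in> borel_measurable borel"
  shows "(\<integral>\<^sup>+z. f z \<partial>conv_measure M N) = (\<integral>\<^sup>+x. \<integral>\<^sup>+y. f (x + y) \<partial>N \<partial>M)"
proof -
  interpret N: sigma_finite_measure N by fact
  have [measurable]: "(\<lambda>z. fst z + snd z) \<in> M \<Otimes>\<^sub>M N \<rightarrow>\<^sub>M borel" by measurable
  have "(\<integral>\<^sup>+z. f z \<partial>conv_measure M N) = (\<integral>\<^sup>+z. f (fst z + snd z) \<partial>(M \<Otimes>\<^sub>M N))"
    unfolding conv_measure_def case_prod_beta by (rule nn_integral_distr) measurable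
  also have "\<dots> = (\<integral>\<^sup>+x. \<integral>\<^sup>+y. f (x + y) \<partial>N \<partial>M)"
    using N.nn_integral_fst[of "\<lambda>z. f (fst z + snd z)" M] by simp
  finally show ?thesis .
qed

lemma borel_measurable_blinfun [measurable]: "blinfun_apply L \<in> borel_measurable borel"
  by (intro borel_measurable_continuous_onI continuous_intros)

lemma distr_conv_measure:
  fixes M N :: "'a::{real_normed_vector,second_countable_topology} measure"
    and L :: "'a \<Rightarrow>\<^sub>L 'b::{real_normed_vector,second_countable_topology}"
  assumes "prob_space M" "prob_space N" and [measurable_cong]: "sets M = sets borel" "sets N = sets borel"
  shows "distr (conv_measure M N) borel (blinfun_apply L) =
    conv_measure (distr M borel (blinfun_apply L)) (distr N borel (blinfun_apply L))"
proof -
  interpret LN: prob_space "distr N borel (blinfun_apply L)"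
    by (intro prob_space.prob_space_distr assms) simp
  have LL: "distr M borel (blinfun_apply L) \<Otimes>\<^sub>M distr N borel (blinfun_apply L) =
      distr (M \<Otimes>\<^sub>M N) (borel \<Otimes>\<^sub>M borel) (\<lambda>(x, y). (blinfun_apply L x, blinfun_apply L y))"
    by (intro pair_measure_distr) (auto intro: LN.sigma_finite_measure_axioms)
  have "conv_measure (distr M borel (blinfun_apply L)) (distr N borel (blinfun_apply L)) =
      distr (M \<Otimes>\<^sub>M N) borel ((\<lambda>(x, y). x + y) \<circ> (\<lambda>(x, y). (L x, L y)))"
    unfolding conv_measure_def LL by (rule distr_distr) measurable
  also have "\<dots> = distr (M \<Otimes>\<^sub>M N) borel (blinfun_apply L \<circ> (\<lambda>(x, y). x + y))"
    by (intro arg_cong[where f="distr _ _"]) (auto simp: blinfun.add_right)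
  also have "\<dots> = distr (conv_measure M N) borel (blinfun_apply L)"
    unfolding conv_measure_def by (rule distr_distr[symmetric]) measurable
  finally show ?thesis ..
qed

text \<open>
  If \<open>X\<close> and \<open>Y\<close> are independent with laws \<open>M\<close> and \<open>N\<close>, then \<open>\<parallel>X\<parallel> \<le> \<parallel>X + Y\<parallel> + \<parallel>Y\<parallel>\<close>, so a large
  \<open>X\<close> forces one of \<open>X + Y\<close> and \<open>Y\<close> to be large. When the sum and \<open>Y\<close> are both close to zero, this
  makes the remaining summand degenerate, which identifies \<open>\<mu> t t\<close> in the main proof.
\<close>

lemma tail_le_conv_measure:
  fixes M N :: "'a::{real_normed_vector,second_countable_topology} measure"
  assumes "prob_space M" "prob_space N" and [measurable_cong]: "sets M = sets borel" "sets N = sets borel"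
  shows "measure M {x. norm x > 2 * e} \<le> measure (conv_measure M N) {x. norm x > e} + measure N {x. norm x > e}"
proof -
  interpret M: prob_space M by fact
  interpret N: prob_space N by fact
  interpret P: prob_space "M \<Otimes>\<^sub>M N" by (rule prob_space_pair) fact+
  have sp: "space M = UNIV" "space N = UNIV" using sets_eq_imp_space_eq[OF assms(3)] sets_eq_imp_space_eq[OF assms(4)] by simp_all
  have a: "measure M {x. norm x > 2 * e} = measure (M \<Otimes>\<^sub>M N) {z. norm (fst z) > 2 * e}"
  proof -
    have "{z::'a \<times> 'a. norm (fst z) > 2 * e} = {x. norm x > 2 * e} \<times> space N" by (auto simp: sp)
    then show ?thesis
      using N.emeasure_pair_measure_Times[of "{x. norm x > 2 * e}" M "space N"]
      by (simp add: measure_def assms(3) N.emeasure_space_1)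
  qed
  have b: "measure N {x. norm x > e} = measure (M \<Otimes>\<^sub>M N) {z. norm (snd z) > e}"
  proof -
    have "{z::'a \<times> 'a. norm (snd z) > e} = space M \<times> {x. norm x > e}" by (auto simp: sp)
    then show ?thesis
      using N.emeasure_pair_measure_Times[of "space M" M "{x. norm x > e}"]
      by (simp add: measure_def assms(4) M.emeasure_space_1)
  qed
  have c: "measure (conv_measure M N) {x. norm x > e} = measure (M \<Otimes>\<^sub>M N) {z. norm (fst z + snd z) > e}"
    unfolding conv_measure_def
    by (subst measure_distr) (auto simp: space_pair_measure sp vimage_def case_prod_beta)
  have "{z \<in> space (M \<Otimes>\<^sub>M N). norm (fst z + snd z) > e} \<in> sets (M \<Otimes>\<^sub>M N)"
    "{z \<in> space (M \<Otimes>\<^sub>M N). norm (snd z) > e} \<in> sets (M \<Otimes>\<^sub>M N)"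
    by measurable
  then have m: "{z. norm (fst z + snd z) > e} \<in> sets (M \<Otimes>\<^sub>M N)" "{z. norm (snd z) > e} \<in> sets (M \<Otimes>\<^sub>M N)"
    by (simp_all add: space_pair_measure sp)
  have "measure (M \<Otimes>\<^sub>M N) {z. norm (fst z) > 2 * e}
     \<le> measure (M \<Otimes>\<^sub>M N) ({z. norm (fst z + snd z) > e} \<union> {z. norm (snd z) > e})"
  proof (intro P.finite_measure_mono sets.Un m subsetI)
    fix z :: "'a \<times> 'a" assume "z \<in> {z. norm (fst z) > 2 * e}"
    moreover have "norm (fst z) \<le> norm (fst z + snd z) + norm (snd z)"
      using norm_triangle_ineq4[of "fst z + snd z" "snd z"] by simp
    ultimately show "z \<in> {z. norm (fst z + snd z) > e} \<union> {z. norm (snd z) > e}" by auto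
  qed
  also have "\<dots> \<le> measure (M \<Otimes>\<^sub>M N) {z. norm (fst z + snd z) > e} + measure (M \<Otimes>\<^sub>M N) {z. norm (snd z) > e}"
    by (intro measure_Un_le m)
  finally show ?thesis by (simp add: a b c)
qed

lemma eq_return_0_if_tails_0:
  fixes M :: "'a::real_normed_vector measure"
  assumes "prob_space M" and [measurable_cong]: "sets M = sets borel"
    and tails: "\<And>e. e > 0 \<Longrightarrow> measure M {x. norm x > e} = 0"
  shows "M = return borel 0"
proof -
  interpret prob_space M by fact
  have sp: "space M = UNIV" using sets_eq_imp_space_eq[OF assms(2)] by simp
  have "AE x in M. norm x \<le> inverse (Suc n)" for n
  proof (rule AE_I')
    show "{x. norm x > inverse (real (Suc n))} \<in> null_sets M"
      using tails[of "inverse (Suc n)"] by (auto simp: null_sets_def emeasure_eq_measure assms(2))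
  qed (auto simp: sp)
  then have "AE x in M. \<forall>n. norm x \<le> inverse (Suc n)" by (simp add: AE_all_countable)
  then have "AE x in M. x = 0"
  proof (rule AE_mp, intro AE_I2 impI)
    fix x :: 'a assume *: "\<forall>n. norm x \<le> inverse (Suc n)"
    then have "\<not> norm x > 0" using reals_Archimedean[of "norm x"] by (meson not_less)
    then show "x = 0" by simp
  qed
  then have "distr M borel (\<lambda>x. x) = distr M borel (\<lambda>x. 0)"
    by (intro distr_cong_AE) auto
  moreover have "distr M borel (\<lambda>x. x) = M" using distr_id2[of borel M] assms(2) by simp
  ultimately show ?thesis by (simp add: distr_const)
qed

text \<open>
  For a limit concentrated at one point, weak convergence is convergence in probability. The test
  function \<open>x \<mapsto> min 1 (\<parallel>x\<parallel> / e)\<close> dominates the tail indicator and vanishes at zero; conversely the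
  integral of a bounded continuous function is split at a small ball around zero. This form is easy to
  push through linear maps and is what stochastic continuity asks for.
\<close>

lemma weak_conv_along_return_0_iff_tails:
  fixes M :: "'i \<Rightarrow> 'a::real_normed_vector measure"
  assumes M: "\<forall>\<^sub>F i in F. prob_space (M i) \<and> sets (M i) = sets borel"
  shows "weak_conv_along M (return borel 0) F \<longleftrightarrow>
    (\<forall>e>0. ((\<lambda>i. measure (M i) {x. norm x > e}) \<longlongrightarrow> 0) F)"
proof (intro iffI allI impI)
  fix e :: real
  assume wc: "weak_conv_along M (return borel 0) F" and e: "e > 0"
  define f where "f x = min 1 (norm x / e)" for x :: 'a
  have cont: "continuous_on UNIV f"
    unfolding f_def by (intro continuous_intros) (use e in auto)
  have [measurable]: "f \<in> borel_measurable borel"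
    using cont by (rule borel_measurable_continuous_onI)
  have f01: "0 \<le> f x" "f x \<le> 1" for x using e by (auto simp: f_def)
  have "bounded (range f)" unfolding bounded_iff using f01 by (auto intro!: exI[of _ 1])
  with wc cont have "((\<lambda>i. \<integral>x. f x \<partial>M i) \<longlongrightarrow> (\<integral>x. f x \<partial>return borel 0)) F"
    unfolding weak_conv_along_def by blast
  moreover have "(\<integral>x. f x \<partial>return borel 0) = 0" by (subst integral_return) (auto simp: f_def)
  ultimately have lim: "((\<lambda>i. \<integral>x. f x \<partial>M i) \<longlongrightarrow> 0) F" by simp
  show "((\<lambda>i. measure (M i) {x. norm x > e}) \<longlongrightarrow> 0) F"
  proof (rule tendsto_sandwich[OF _ _ tendsto_const lim])
    show "\<forall>\<^sub>F i in F. measure (M i) {x. norm x > e} \<le> (\<integral>x. f x \<partial>M i)"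
      using M
    proof (rule eventually_mono)
      fix i assume i: "prob_space (M i) \<and> sets (M i) = sets borel"
      then interpret prob_space "M i" by simp
      have [measurable_cong]: "sets (M i) = sets borel" using i by simp
      have "measure (M i) {x. norm x > e} = (\<integral>x. indicator {x. norm x > e} x \<partial>M i)"
        using i sets_eq_imp_space_eq[of "M i" borel] by simp
      also have "\<dots> \<le> (\<integral>x. f x \<partial>M i)"
      proof (rule integral_mono)
        show "integrable (M i) (indicat_real {x. norm x > e})"
          by (rule integrable_real_indicator) (auto simp: i less_top[symmetric])
        show "integrable (M i) f"
          by (rule integrable_const_bound[where B=1]) (use f01 in auto)
        show "indicat_real {x. norm x > e} x \<le> f x" for x
          using e f01 by (auto simp: indicator_def f_def)
      qed
      finally show "measure (M i) {x. norm x > e} \<le> (\<integral>x. f x \<partial>M i)" .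
    qed
  qed simp
next
  assume tails: "\<forall>e>0. ((\<lambda>i. measure (M i) {x. norm x > e}) \<longlongrightarrow> 0) F"
  show "weak_conv_along M (return borel 0) F"
    unfolding weak_conv_along_def
  proof (intro allI impI)
    fix f :: "'a \<Rightarrow> real" assume cont: "continuous_on UNIV f" and "bounded (range f)"
    then obtain B where B: "\<And>x. \<bar>f x\<bar> \<le> B" unfolding bounded_iff by auto
    have B0: "B \<ge> 0" using B[of 0] by simp
    have [measurable]: "f \<in> borel_measurable borel"
      using cont by (rule borel_measurable_continuous_onI)
    have f0: "(\<integral>x. f x \<partial>return borel 0) = f 0" by (subst integral_return) auto
    have "((\<lambda>i. \<integral>x. f x \<partial>M i) \<longlongrightarrow> f 0) F"
      unfolding tendsto_iff
    proof (intro allI impI)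
      fix e :: real assume e: "e > 0"
      obtain d where d: "d > 0" "\<And>x. norm x < d \<Longrightarrow> \<bar>f x - f 0\<bar> < e / 2"
        using cont e unfolding continuous_on_iff dist_norm
        by (metis UNIV_I diff_0_right half_gt_zero real_norm_def)
      \<comment> \<open>The mass \<open>c\<close> outside the ball costs at most \<open>2 * B * c\<close>; adding 2 avoids dividing by zero when \<open>B = 0\<close>.\<close>
      define c where "c = e / (4 * B + 2)"
      have c: "c > 0" using e B0 by (simp add: c_def add_nonneg_pos)
      have "\<forall>\<^sub>F i in F. measure (M i) {x. norm x > d / 2} < c"
        using order_tendstoD(2)[OF tails[rule_format, of "d / 2"] c] d(1) by simp
      with M show "\<forall>\<^sub>F i in F. dist (\<integral>x. f x \<partial>M i) (f 0) < e"
      proof eventually_elim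
        case (elim i)
        then interpret prob_space "M i" by simp
        have [measurable_cong]: "sets (M i) = sets borel" using elim by simp
        have sp: "space (M i) = UNIV" using elim sets_eq_imp_space_eq[of "M i" borel] by simp
        have int_f: "integrable (M i) f"
          by (rule integrable_const_bound[where B=B]) (use B in auto)
        have int_ind: "integrable (M i) (indicat_real {x. norm x > d / 2})"
          by (rule integrable_real_indicator) (auto simp: elim less_top[symmetric])
        have "(\<integral>x. f x \<partial>M i) - f 0 = (\<integral>x. f x - f 0 \<partial>M i)"
          using int_f by (simp add: prob_space)
        also have "\<bar>\<dots>\<bar> \<le> (\<integral>x. \<bar>f x - f 0\<bar> \<partial>M i)" by (rule integral_abs_bound)
        also have "\<dots> \<le> (\<integral>x. e / 2 + 2 * B * indicator {x. norm x > d / 2} x \<partial>M i)"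
        proof (rule integral_mono)
          show "\<bar>f x - f 0\<bar> \<le> e / 2 + 2 * B * indicator {x. norm x > d / 2} x" for x
            using d B[of x] B[of 0] e by (cases "norm x > d / 2") (force simp: less_imp_le)+
        qed (use int_f int_ind in auto)
        also have "\<dots> = e / 2 + 2 * B * measure (M i) {x. norm x > d / 2}"
          using int_ind prob_space sp by simp
        also have "\<dots> \<le> e / 2 + 2 * B * c"
          using elim B0 by (intro add_left_mono mult_left_mono) auto
        also have "\<dots> < e" using e B0 by (simp add: c_def field_simps add_nonneg_pos)
        finally show ?case by (simp add: dist_real_def)
      qed
    qed
    then show "((\<lambda>i. \<integral>x. f x \<partial>M i) \<longlongrightarrow> (\<integral>x. f x \<partial>return borel 0)) F" using f0 by simp
  qed
qed

section \<open>Uniform boundedness\<close>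

text \<open>
  The Banach--Steinhaus theorem. The closed sets of points at which the family is bounded by a fixed
  natural number cover the space, so by Baire one of them contains a ball, and translating
  that ball to the origin costs a factor of two.
\<close>

lemma uniform_boundedness:
  fixes L :: "'i \<Rightarrow> 'a::{real_normed_vector,complete_space} \<Rightarrow>\<^sub>L 'b::real_normed_vector"
  assumes pointwise: "\<And>x. \<exists>C. \<forall>i\<in>I. norm (L i x) \<le> C"
  shows "\<exists>C. \<forall>i\<in>I. norm (L i) \<le> C"
proof -
  define B where "B n = {x. \<forall>i\<in>I. norm (L i x) \<le> real n}" for n
  have closed: "closed (B n)" for n
  proof -
    have "B n = (\<Inter>i\<in>I. {x. norm (L i x) \<le> real n})" by (auto simp: B_def)
    then show ?thesis by (auto intro!: closed_INT closed_Collect_le continuous_intros)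
  qed
  have cover: "(\<Union>n. B n) = UNIV"
  proof (intro equalityI subset_UNIV subsetI)
    fix x obtain C where "\<forall>i\<in>I. norm (L i x) \<le> C" using pointwise by blast
    moreover obtain n where "C \<le> real n" using real_arch_simple by blast
    ultimately have "x \<in> B n" by (auto simp: B_def intro: order_trans)
    then show "x \<in> (\<Union>n. B n)" by blast
  qed
  have "\<exists>n. interior (B n) \<noteq> {}"
  proof (rule ccontr)
    assume *: "\<not> (\<exists>n. interior (B n) \<noteq> {})"
    have "(euclidean :: 'a topology) interior_of (\<Union>(range B)) = {}"
      by (rule Baire_category_alt)
        (use * closed in \<open>auto simp: completely_metrizable_space_euclidean\<close>)
    then show False using cover by simp
  qed
  then obtain n x where "x \<in> interior (B n)" by blast
  then obtain r where r: "r > 0" "cball x r \<subseteq> B n" by (meson mem_interior_cball)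
  have "norm (L i) \<le> 2 * real n / r" if i: "i \<in> I" for i
  proof (rule norm_blinfun_bound)
    fix y
    show "norm (L i y) \<le> 2 * real n / r * norm y"
    proof (cases "y = 0")
      case False
      define z where "z = (r / norm y) *\<^sub>R y"
      have "x + z \<in> B n" "x \<in> B n"
        using r False by (auto intro!: subsetD[OF r(2)] simp: z_def dist_norm)
      then have "norm (L i (x + z)) \<le> n" "norm (L i x) \<le> n" using i by (auto simp: B_def)
      moreover have "L i z = L i (x + z) - L i x" by (simp add: blinfun.add_right)
      ultimately have "norm (L i z) \<le> 2 * real n"
        using norm_triangle_ineq4[of "L i (x + z)" "L i x"] by simp
      then show ?thesis using False r(1) by (simp add: z_def blinfun.scaleR_right field_simps)
    qed simp
  qed (use r in auto)
  then show ?thesis by blast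
qed

section \<open>Independence in product measures\<close>

text \<open>
  Adding one independent coordinate to another leaves an independent family and convolves the two
  laws. This is the whole probabilistic content of consistency of the finite-dimensional
  distributions: dropping an intermediate time merges two neighbouring increments.
\<close>

lemma distr_PiM_merge_coordinates:
  fixes M :: "'i \<Rightarrow> 'a::{second_countable_topology,topological_monoid_add} measure"
  assumes prob: "\<And>i. prob_space (M i)" and sets: "\<And>i. sets (M i) = sets borel"
    and K: "finite K" "p \<notin> K" "k \<notin> K" "k \<noteq> p"
  shows "distr (PiM (insert p (insert k K)) M) (PiM (insert p K) (\<lambda>_. borel))
      (\<lambda>x. restrict (x(p := x k + x p)) (insert p K)) =
    PiM (insert p K) (M(p := conv_measure (M k) (M p)))"
    (is "distr ?H ?B ?m = PiM ?J ?M'")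
proof (rule measure_eqI)
  interpret P: product_prob_space M by (rule product_prob_spaceI) (rule prob)
  have prob': "prob_space (?M' i)" for i
    by (simp add: prob prob_space_conv_measure sets)
  interpret P': product_prob_space ?M' by (rule product_prob_spaceI) (rule prob')
  note [measurable_cong] = sets
  have sets': "sets (PiM ?J ?M') = sets ?B"
    by (rule sets_PiM_cong) (auto simp: sets)
  have setsM: "sets (PiM L M) = sets (PiM L (\<lambda>_. borel))" for L
    by (rule sets_PiM_cong) (auto simp: sets)
  show "sets (distr ?H ?B ?m) = sets (PiM ?J ?M')" by (simp add: sets')
  have m [measurable]: "?m \<in> ?H \<rightarrow>\<^sub>M ?B"
    by (rule measurable_restrict) (auto simp: fun_upd_def)
  fix A assume "A \<in> sets (distr ?H ?B ?m)"
  then have A [measurable]: "A \<in> sets ?B" by simp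
  define f where "f = (indicator A :: _ \<Rightarrow> ennreal)"
  have f [measurable]: "f \<in> borel_measurable ?B" by (simp add: f_def)
  have f': "f \<in> borel_measurable (PiM ?J ?M')"
    using f by (simp add: measurable_cong_sets[OF sets' refl])
  have upd: "(\<lambda>y. f (x(p := y))) \<in> borel_measurable borel" if "x \<in> space (PiM K (\<lambda>_. borel))" for x
    using that by measurable
  \<comment> \<open>Coordinate \<open>p\<close> is integrated innermost and \<open>k\<close> next, the order in which the convolution unfolds.\<close>
  have "emeasure (distr ?H ?B ?m) A = (\<integral>\<^sup>+\<omega>. f (?m \<omega>) \<partial>?H)"
  proof -
    have "emeasure (distr ?H ?B ?m) A = (\<integral>\<^sup>+z. f z \<partial>distr ?H ?B ?m)"
      by (simp add: f_def)
    also have "\<dots> = (\<integral>\<^sup>+\<omega>. f (?m \<omega>) \<partial>?H)" by (rule nn_integral_distr[OF m]) (use f in simp)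
    finally show ?thesis .
  qed
  also have "\<dots> = (\<integral>\<^sup>+x. \<integral>\<^sup>+a. f (?m (x(p := a))) \<partial>M p \<partial>PiM (insert k K) M)"
    by (rule P.product_nn_integral_insert) (use K in auto)
  also have "\<dots> = (\<integral>\<^sup>+x. \<integral>\<^sup>+b. \<integral>\<^sup>+a. f (?m (x(k := b, p := a))) \<partial>M p \<partial>M k \<partial>PiM K M)"
  proof (rule P.product_nn_integral_insert)
    have "(\<lambda>(x, a). f (?m (x(p := a)))) \<in> borel_measurable (PiM (insert k K) M \<Otimes>\<^sub>M M p)"
      using measurable_compose[OF measurable_add_dim measurable_compose[OF m f]]
      by (simp only: case_prod_beta')
    then show "(\<lambda>x. \<integral>\<^sup>+a. f (?m (x(p := a))) \<partial>M p) \<in> borel_measurable (PiM (insert k K) M)"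
      by (rule P.M.borel_measurable_nn_integral)
  qed (use K in auto)
  also have "\<dots> = (\<integral>\<^sup>+x. \<integral>\<^sup>+b. \<integral>\<^sup>+a. f (x(p := b + a)) \<partial>M p \<partial>M k \<partial>PiM K M)"
  proof (rule nn_integral_cong)
    fix x assume "x \<in> space (PiM K M)"
    then have "?m (x(k := b, p := a)) = x(p := b + a)" for a b
      using K by (auto simp: fun_eq_iff space_PiM PiE_def extensional_def restrict_def)
    then show "(\<integral>\<^sup>+b. \<integral>\<^sup>+a. f (?m (x(k := b, p := a))) \<partial>M p \<partial>M k) =
      (\<integral>\<^sup>+b. \<integral>\<^sup>+a. f (x(p := b + a)) \<partial>M p \<partial>M k)" by simp
  qed
  also have "\<dots> = (\<integral>\<^sup>+x. \<integral>\<^sup>+c. f (x(p := c)) \<partial>conv_measure (M k) (M p) \<partial>PiM K M)"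
  proof (intro nn_integral_cong nn_integral_conv_measure[symmetric] upd)
    show "sigma_finite_measure (M p)" by (rule P.sigma_finite_measures)
  qed (auto simp: sets space_PiM sets_eq_imp_space_eq[OF sets] setsM)
  also have "PiM K M = PiM K ?M'"
    by (rule PiM_cong) (use K in auto)
  also have "(\<integral>\<^sup>+x. \<integral>\<^sup>+c. f (x(p := c)) \<partial>conv_measure (M k) (M p) \<partial>PiM K ?M') =
      (\<integral>\<^sup>+x. \<integral>\<^sup>+c. f (x(p := c)) \<partial>?M' p \<partial>PiM K ?M')"
    by simp
  also have "\<dots> = (\<integral>\<^sup>+\<omega>. f \<omega> \<partial>PiM ?J ?M')"
    by (rule P'.product_nn_integral_insert[symmetric]) (use K f' in auto)
  also have "\<dots> = emeasure (PiM ?J ?M') A"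
    using A sets' by (simp add: f_def)
  finally show "emeasure (distr ?H ?B ?m) A = emeasure (PiM ?J ?M') A" .
qed

text \<open>
  Independence depends only on the joint law, so it can be checked after transport to any space
  that carries the same law.
\<close>

lemma (in prob_space) indep_vars_distr_iff:
  fixes X :: "'i \<Rightarrow> 'b \<Rightarrow> 'c"
  assumes I: "I \<noteq> {}" and T: "T \<in> M \<rightarrow>\<^sub>M N" and rv: "\<And>i. i \<in> I \<Longrightarrow> X i \<in> N \<rightarrow>\<^sub>M K i"
  shows "prob_space.indep_vars (distr M N T) K X I \<longleftrightarrow> indep_vars K (\<lambda>i \<omega>. X i (T \<omega>)) I"
proof -
  interpret N: prob_space "distr M N T" by (rule prob_space_distr) (rule T)
  have "distr (distr M N T) (PiM I K) (\<lambda>x. \<lambda>i\<in>I. X i x) = distr M (PiM I K) (\<lambda>x. \<lambda>i\<in>I. X i (T x))"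
    by (subst distr_distr) (auto simp: comp_def rv T intro!: measurable_restrict)
  moreover have "distr (distr M N T) (K i) (X i) = distr M (K i) (\<lambda>x. X i (T x))" if "i \<in> I" for i
    by (subst distr_distr) (auto simp: comp_def rv T that)
  then have "PiM I (\<lambda>i. distr (distr M N T) (K i) (X i)) = PiM I (\<lambda>i. distr M (K i) (\<lambda>x. X i (T x)))"
    by (intro PiM_cong) auto
  moreover have "(\<lambda>x. X i (T x)) \<in> M \<rightarrow>\<^sub>M K i" if "i \<in> I" for i
    using measurable_comp[OF T rv[OF that]] by (simp add: comp_def)
  ultimately show ?thesis
    by (subst N.indep_vars_iff_distr_eq_PiM'[OF I]) (auto simp: rv indep_vars_iff_distr_eq_PiM'[OF I])
qed

lemma indep_vars_PiM_coordinates: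
  assumes M: "\<And>i. i \<in> K \<Longrightarrow> prob_space (M i)" and f: "inj_on f I" "f \<in> I \<rightarrow> K" and I: "I \<noteq> {}"
  shows "prob_space.indep_vars (PiM K M) (\<lambda>i. M (f i)) (\<lambda>i \<omega>. \<omega> (f i)) I"
proof -
  interpret prob_space "PiM K M" by (rule prob_space_PiM) (rule M)
  have rv: "(\<lambda>\<omega>. \<omega> (f i)) \<in> PiM K M \<rightarrow>\<^sub>M M (f i)" if "i \<in> I" for i
    using f that by (intro measurable_component_singleton) auto
  have "PiM I (\<lambda>i. distr (PiM K M) (M (f i)) (\<lambda>\<omega>. \<omega> (f i))) = PiM I (\<lambda>i. M (f i))"
    using M f by (intro PiM_cong distr_PiM_component) auto
  then show ?thesis
    using distr_PiM_reindex[OF M f] by (simp add: indep_vars_iff_distr_eq_PiM'[OF I rv])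
qed

section \<open>Finite-dimensional distributions of an additive process\<close>

text \<open>
  \<open>\<nu> t s\<close> is meant to be the law of the increment accumulated when time runs down from \<open>t\<close> to \<open>s\<close>.
  The process starts at time \<open>t0\<close> with value zero.
\<close>

locale convolution_hemigroup =
  fixes t0 :: real and \<nu> :: "real \<Rightarrow> real \<Rightarrow> 'a::{real_normed_vector,polish_space} measure"
  assumes prob: "s \<le> t \<Longrightarrow> t \<le> t0 \<Longrightarrow> prob_space (\<nu> t s)"
    and sets: "s \<le> t \<Longrightarrow> t \<le> t0 \<Longrightarrow> sets (\<nu> t s) = sets borel"
    and conv: "s \<le> r \<Longrightarrow> r \<le> t \<Longrightarrow> t \<le> t0 \<Longrightarrow> \<nu> t s = conv_measure (\<nu> t r) (\<nu> r s)"
    and same_time: "s \<le> t0 \<Longrightarrow> \<nu> s s = return borel 0"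
begin

definition next_time :: "real set \<Rightarrow> real \<Rightarrow> real" where
  "next_time J t = Min (insert t0 {u \<in> J. t < u})"

text \<open>
  The law of the increment that ends at \<open>t\<close> and begins at the next larger time of \<open>J\<close>, or at \<open>t0\<close> if there
  is none. The Dirac default for \<open>t > t0\<close> makes every \<open>step_law J t\<close> a probability measure, as the
  locales for product measures demand.
\<close>

definition step_law :: "real set \<Rightarrow> real \<Rightarrow> 'a measure" where
  "step_law J t = (if t \<le> t0 then \<nu> (next_time J t) t else return borel 0)"

text \<open>
  The process value at \<open>t\<close>, as the sum of all increments that end at or above \<open>t\<close>. The coordinate at \<open>t0\<close>
  is left out so that the path starts exactly at zero.
\<close>

definition path_sum :: "real set \<Rightarrow> (real \<Rightarrow> 'a) \<Rightarrow> real \<Rightarrow> 'a" where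
  "path_sum J \<omega> = (\<lambda>t\<in>J. \<Sum>u\<in>{u \<in> J. t \<le> u \<and> u < t0}. \<omega> u)"

definition fdd :: "real set \<Rightarrow> (real \<Rightarrow> 'a) measure" where
  "fdd J = distr (PiM J (step_law J)) (PiM J (\<lambda>_. borel)) (path_sum J)"

lemma next_time_bounds:
  assumes "finite J" "t \<le> t0"
  shows "t \<le> next_time J t" "next_time J t \<le> t0"
  using assms by (auto simp: next_time_def)

lemma prob_space_step: "finite J \<Longrightarrow> prob_space (step_law J t)"
  by (auto simp: step_law_def next_time_bounds intro!: prob prob_space_return)

lemma sets_step: "finite J \<Longrightarrow> sets (step_law J t) = sets borel"
  by (simp add: step_law_def next_time_bounds sets)

lemma sets_PiM_step: "finite J \<Longrightarrow> sets (PiM L (step_law J)) = sets (PiM L (\<lambda>_. borel))"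
  by (intro sets_PiM_cong) (auto simp: sets_step)

lemma measurable_path_sum: "path_sum J \<in> PiM J (\<lambda>_. borel) \<rightarrow>\<^sub>M PiM J (\<lambda>_. borel)"
  unfolding path_sum_def by measurable

lemma measurable_path_sum_step: "finite J \<Longrightarrow> path_sum J \<in> PiM J (step_law J) \<rightarrow>\<^sub>M PiM J (\<lambda>_. borel)"
  using measurable_path_sum by (simp add: measurable_cong_sets[OF sets_PiM_step refl])

lemma prob_space_fdd: "finite J \<Longrightarrow> prob_space (fdd J)"
  unfolding fdd_def
  by (intro prob_space.prob_space_distr prob_space_PiM prob_space_step measurable_path_sum_step)

text \<open>
  Forgetting one time \<open>k\<close>. If \<open>k = t0\<close> or \<open>k\<close> lies below all of \<open>J\<close>, no value at a time in \<open>J\<close> involves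
  the increment that ends at \<open>k\<close>, and it is simply dropped. Otherwise, with \<open>p\<close> the largest time of \<open>J\<close> below
  \<open>k\<close>, the increments ending at \<open>k\<close> and at \<open>p\<close> are merged into the increment that ends at \<open>p\<close>
  relative to \<open>J\<close>; the hemigroup law says that its distribution is the right one.
\<close>

lemma fdd_insert:
  assumes J: "finite J" "J \<subseteq> {..t0}" and k: "k \<notin> J" "k \<le> t0"
  shows "distr (fdd (insert k J)) (PiM J (\<lambda>_. borel)) (\<lambda>\<omega>. restrict \<omega> J) = fdd J"
proof -
  define H where "H = insert k J"
  have H: "finite H" "J \<subseteq> H" using J by (auto simp: H_def)
  note [measurable] = measurable_path_sum measurable_path_sum_step[OF H(1)]
  have restr [measurable]: "(\<lambda>\<omega>. restrict \<omega> J) \<in> PiM H (\<lambda>_. borel) \<rightarrow>\<^sub>M PiM J (\<lambda>_. borel)"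
    by (rule measurable_restrict_subset) (rule H)
  have "distr (fdd H) (PiM J (\<lambda>_. borel)) (\<lambda>\<omega>. restrict \<omega> J) =
      distr (PiM H (step_law H)) (PiM J (\<lambda>_. borel)) (\<lambda>\<omega>. restrict (path_sum H \<omega>) J)"
    unfolding fdd_def by (subst distr_distr) (auto simp: comp_def)
  also have "\<dots> = fdd J"
  proof (cases "k = t0 \<or> (\<forall>t\<in>J. k < t)")
    case True
    have same: "step_law H t = step_law J t" if "t \<in> J" for t
    proof -
      have "insert t0 {u \<in> H. t < u} = insert t0 {u \<in> J. t < u}"
        using True that by (auto simp: H_def)
      then show ?thesis by (simp add: step_law_def next_time_def)
    qed
    have sum: "restrict (path_sum H \<omega>) J = path_sum J (restrict \<omega> J)" for \<omega>
    proof
      fix t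
      have "{u \<in> H. t \<le> u \<and> u < t0} = {u \<in> J. t \<le> u \<and> u < t0}" if "t \<in> J"
        using True that by (auto simp: H_def)
      then show "restrict (path_sum H \<omega>) J t = path_sum J (restrict \<omega> J) t"
        using H(2) by (auto simp: path_sum_def intro!: sum.cong)
    qed
    have "distr (PiM H (step_law H)) (PiM J (step_law H)) (\<lambda>\<omega>. restrict \<omega> J) = PiM J (step_law H)"
    proof -
      interpret P: product_prob_space "step_law H" by (rule product_prob_spaceI) (rule prob_space_step[OF H(1)])
      show ?thesis using P.distr_restrict[OF H(2,1)] ..
    qed
    also have "PiM J (step_law H) = PiM J (step_law J)"
      by (rule PiM_cong) (use same in auto)
    finally have restr_PiM: "distr (PiM H (step_law H)) (PiM J (\<lambda>_. borel)) (\<lambda>\<omega>. restrict \<omega> J) = PiM J (step_law J)"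
      by (simp add: sets_PiM_step[OF H(1)] cong: distr_cong)
    have "distr (PiM H (step_law H)) (PiM J (\<lambda>_. borel)) (path_sum J \<circ> (\<lambda>\<omega>. restrict \<omega> J)) = fdd J"
      unfolding fdd_def restr_PiM[symmetric]
      by (rule distr_distr[symmetric])
        (auto simp: measurable_cong_sets[OF sets_PiM_step[OF H(1)] refl])
    then show ?thesis by (simp add: sum comp_def)
  next
    case False
    define p where "p = Max {t \<in> J. t < k}"
    have kt0: "k < t0" using False k by auto
    have "{t \<in> J. t < k} \<noteq> {}" using False k(1) by (force simp: not_less)
    then have "p \<in> {t \<in> J. t < k}" unfolding p_def using J(1) by (intro Max_in) auto
    then have p: "p \<in> J" "p < k" by auto
    have p_max: "t \<le> p" if "t \<in> J" "t < k" for t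
      unfolding p_def using J(1) that by (intro Max_ge) auto
    have ins: "next_time H t = next_time J t" if "t \<in> J" "t \<noteq> p" for t
    proof (cases "t < k")
      case True
      then have "p \<in> {u \<in> J. t < u}" using p_max[OF that(1)] p that by auto
      then have "next_time J t \<le> p" unfolding next_time_def using J(1) by (intro Min_le) auto
      moreover have ins_k: "insert t0 {u \<in> H. t < u} = insert k (insert t0 {u \<in> J. t < u})"
        using True by (auto simp: H_def)
      moreover have "next_time H t = min k (next_time J t)"
        unfolding next_time_def using J(1) by (subst ins_k, intro Min_insert) auto
      ultimately show ?thesis using p by simp
    next
      case False
      then show ?thesis unfolding next_time_def H_def
        by (intro arg_cong[where f=Min]) auto
    qed
    have up_p: "next_time H p = k"
      unfolding next_time_def
    proof (rule Min_eqI)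
      show "k \<le> u" if "u \<in> insert t0 {u \<in> H. p < u}" for u
        using that p_max[of u] kt0 by (auto simp: H_def not_less[symmetric])
    qed (use H p in \<open>auto simp: H_def\<close>)
    have "k < u \<longleftrightarrow> p < u" if "u \<in> J" for u
      using p(2) p_max[OF that] that k(1) by (metis leD less_trans linorder_cases)
    then have up_k: "next_time H k = next_time J p"
      unfolding next_time_def H_def by (intro arg_cong[where f=Min]) auto
    define K where "K = J - {p}"
    have K: "finite K" "p \<notin> K" "k \<notin> K" "k \<noteq> p" "J = insert p K" "H = insert p (insert k K)"
      using J p k by (auto simp: K_def H_def)
    have step_J: "step_law J t = ((step_law H)(p := conv_measure (step_law H k) (step_law H p))) t" if "t \<in> J" for t
    proof (cases "t = p")
      case True
      then show ?thesis
        using conv[of p k "next_time J p"] next_time_bounds[OF H(1), of k] k p kt0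
        by (simp add: step_law_def up_p up_k)
    next
      case False
      then show ?thesis using ins[OF that] by (simp add: step_law_def)
    qed
    define m where "m x = restrict (x(p := x k + x p)) J" for x :: "real \<Rightarrow> 'a"
    have m: "m \<in> PiM H (step_law H) \<rightarrow>\<^sub>M PiM J (\<lambda>_. borel)"
      unfolding measurable_cong_sets[OF sets_PiM_step[OF H(1)] refl] m_def
      using p by (intro measurable_restrict) (auto simp: fun_upd_def H_def)
    have merge: "distr (PiM H (step_law H)) (PiM J (\<lambda>_. borel)) m = PiM J (step_law J)"
    proof -
      have "distr (PiM H (step_law H)) (PiM J (\<lambda>_. borel)) m =
          PiM J ((step_law H)(p := conv_measure (step_law H k) (step_law H p)))"
        unfolding K(5,6) m_def
        by (rule distr_PiM_merge_coordinates)
          (use K(1-4) prob_space_step[OF H(1)] sets_step[OF H(1)] in \<open>auto simp flip: K(6)\<close>)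
      also have "\<dots> = PiM J (step_law J)"
        by (rule PiM_cong) (auto simp: step_J)
      finally show ?thesis .
    qed
    have sum: "restrict (path_sum H \<omega>) J = path_sum J (m \<omega>)" for \<omega>
    proof
      fix t
      let ?A = "{u \<in> J. t \<le> u \<and> u < t0}"
      have fin: "finite ?A" using J by auto
      have "(\<Sum>u\<in>{u \<in> H. t \<le> u \<and> u < t0}. \<omega> u) = (\<Sum>u\<in>?A. m \<omega> u)" if t: "t \<in> J"
      proof (cases "t \<le> p")
        case True
        have A: "{u \<in> H. t \<le> u \<and> u < t0} = insert k ?A" "k \<notin> ?A" "p \<in> ?A"
          using True p k kt0 by (auto simp: H_def)
        have "(\<Sum>u\<in>{u \<in> H. t \<le> u \<and> u < t0}. \<omega> u) = \<omega> k + (\<omega> p + (\<Sum>u\<in>?A - {p}. \<omega> u))"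
          using fin A by (simp add: sum.remove[OF fin A(3)])
        also have "\<dots> = m \<omega> p + (\<Sum>u\<in>?A - {p}. m \<omega> u)"
          using p by (auto simp: m_def add.assoc intro!: sum.cong)
        also have "\<dots> = (\<Sum>u\<in>?A. m \<omega> u)" by (rule sum.remove[OF fin A(3), symmetric])
        finally show ?thesis .
      next
        case False
        then have "k < t" using p_max[OF t] t k(1) by (metis linorder_cases)
        then have "{u \<in> H. t \<le> u \<and> u < t0} = ?A" by (auto simp: H_def)
        then show ?thesis using False by (auto simp: m_def intro!: sum.cong)
      qed
      then show "restrict (path_sum H \<omega>) J t = path_sum J (m \<omega>) t"
        using H(2) by (auto simp: path_sum_def)
    qed
    have "distr (PiM H (step_law H)) (PiM J (\<lambda>_. borel)) (path_sum J \<circ> m) = fdd J"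
      unfolding fdd_def merge[symmetric]
      by (rule distr_distr[symmetric]) (auto intro: m)
    then show ?thesis by (simp add: sum comp_def)
  qed
  finally show ?thesis by (simp add: H_def)
qed

lemma fdd_restrict:
  assumes "finite H" "J \<subseteq> H" "H \<subseteq> {..t0}"
  shows "fdd J = distr (fdd H) (PiM J (\<lambda>_. borel)) (\<lambda>\<omega>. restrict \<omega> J)"
proof -
  have J: "finite J" "J \<subseteq> {..t0}" using assms by (auto intro: finite_subset)
  have "fdd J = distr (fdd (J \<union> D)) (PiM J (\<lambda>_. borel)) (\<lambda>\<omega>. restrict \<omega> J)"
    if "finite D" "D \<inter> J = {}" "D \<subseteq> {..t0}" for D
    using that
  proof (induction D rule: finite_induct)
    case empty
    have "restrict \<omega> J = \<omega>" if "\<omega> \<in> space (fdd J)" for \<omega>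
      using that by (auto simp: fdd_def space_PiM PiE_def intro!: extensional_restrict)
    then have "distr (fdd J) (PiM J (\<lambda>_. borel)) (\<lambda>\<omega>. restrict \<omega> J) = distr (fdd J) (fdd J) (\<lambda>\<omega>. \<omega>)"
      by (intro distr_cong) (auto simp: fdd_def)
    also have "\<dots> = fdd J" by simp
    finally show ?case unfolding Un_empty_right ..
  next
    case (insert k D)
    let ?H = "J \<union> D"
    have "fdd J = distr (distr (fdd (insert k ?H)) (PiM ?H (\<lambda>_. borel)) (\<lambda>\<omega>. restrict \<omega> ?H))
        (PiM J (\<lambda>_. borel)) (\<lambda>\<omega>. restrict \<omega> J)"
    proof -
      have "distr (fdd (insert k ?H)) (PiM ?H (\<lambda>_. borel)) (\<lambda>\<omega>. restrict \<omega> ?H) = fdd ?H"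
        by (rule fdd_insert) (use insert.prems insert.hyps J in auto)
      moreover have "fdd J = distr (fdd ?H) (PiM J (\<lambda>_. borel)) (\<lambda>\<omega>. restrict \<omega> J)"
        by (rule insert.IH) (use insert.prems in auto)
      ultimately show ?thesis by (simp only:)
    qed
    also have "\<dots> = distr (fdd (insert k ?H)) (PiM J (\<lambda>_. borel)) (\<lambda>\<omega>. restrict \<omega> J)"
    proof (subst distr_distr)
      show "(\<lambda>\<omega>. restrict \<omega> J) \<in> PiM ?H (\<lambda>_. borel) \<rightarrow>\<^sub>M PiM J (\<lambda>_. borel)"
        by (rule measurable_restrict_subset) auto
      have "(\<lambda>\<omega>. restrict \<omega> ?H) \<in> PiM (insert k ?H) (\<lambda>_. borel) \<rightarrow>\<^sub>M PiM ?H (\<lambda>_. borel)"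
        by (rule measurable_restrict_subset) auto
      then show "(\<lambda>\<omega>. restrict \<omega> ?H) \<in> fdd (insert k ?H) \<rightarrow>\<^sub>M PiM ?H (\<lambda>_. borel)"
        by (simp add: fdd_def)
    qed (simp add: comp_def Int_absorb1 Int_commute)
    finally show ?case unfolding Un_insert_right .
  qed
  from this[of "H - J"] have "fdd J = distr (fdd (J \<union> (H - J))) (PiM J (\<lambda>_. borel)) (\<lambda>\<omega>. restrict \<omega> J)"
    using assms by blast
  moreover have "J \<union> (H - J) = H" using assms by blast
  ultimately show ?thesis by (simp only:)
qed

end

text \<open>
  Kolmogorov's extension theorem applies because the state space is Polish; \<open>paths.lim\<close> is the law of
  the whole process, realised on the functions on \<open>{..t0}\<close>.
\<close>

sublocale convolution_hemigroup \<subseteq> paths: polish_projective "{..t0}" fdd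
proof (rule polish_projective.intro, rule projective_family.intro)
  show "fdd J = distr (fdd H) (PiM J (\<lambda>_. borel)) (\<lambda>\<omega>. restrict \<omega> J)"
    if "J \<subseteq> H" "finite H" "H \<subseteq> {..t0}" for J H
    using that by (intro fdd_restrict)
  show "prob_space (fdd J)" if "finite J" "J \<subseteq> {..t0}" for J
    using that by (intro prob_space_fdd)
qed

section \<open>The process with independent increments\<close>

context convolution_hemigroup
begin

lemma measurable_restrict_paths:
  "J \<subseteq> {..t0} \<Longrightarrow> (\<lambda>\<omega>. restrict \<omega> J) \<in> paths.lim \<rightarrow>\<^sub>M PiM J (\<lambda>_. borel)"
  unfolding measurable_cong_sets[OF paths.sets_lim refl] by (rule measurable_restrict_subset)

lemma distr_restrict_paths:
  assumes J: "finite J" "J \<subseteq> {..t0}"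
  shows "distr paths.lim (PiM J (\<lambda>_. borel)) (\<lambda>\<omega>. restrict \<omega> J) = fdd J"
proof (rule measure_eqI)
  fix A assume "A \<in> sets (distr paths.lim (PiM J (\<lambda>_. borel)) (\<lambda>\<omega>. restrict \<omega> J))"
  then have A: "A \<in> sets (PiM J (\<lambda>_. borel))" by simp
  then show "emeasure (distr paths.lim (PiM J (\<lambda>_. borel)) (\<lambda>\<omega>. restrict \<omega> J)) A = emeasure (fdd J) A"
    using paths.emeasure_lim_emb[OF J(2,1) A]
    by (simp add: emeasure_distr[OF measurable_restrict_paths[OF J(2)]] prod_emb_def space_PiM)
qed (simp add: fdd_def)

text \<open>
  Any quantity that depends on finitely many times can be computed from independent increments: the
  path is replaced by the partial sums of a product measure.
\<close>

lemma distr_paths_finite: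
  assumes J: "finite J" "J \<subseteq> {..t0}" and g: "g \<in> PiM J (\<lambda>_. borel) \<rightarrow>\<^sub>M N"
  shows "distr paths.lim N (\<lambda>\<omega>. g (restrict \<omega> J)) = distr (PiM J (step_law J)) N (\<lambda>x. g (path_sum J x))"
proof -
  have "distr (distr paths.lim (PiM J (\<lambda>_. borel)) (\<lambda>\<omega>. restrict \<omega> J)) N g =
      distr (distr (PiM J (step_law J)) (PiM J (\<lambda>_. borel)) (path_sum J)) N g"
    by (simp only: distr_restrict_paths[OF J] fdd_def)
  then show ?thesis
    by (simp only: distr_distr[OF g measurable_restrict_paths[OF J(2)]]
      distr_distr[OF g measurable_path_sum_step[OF J(1)]] comp_def)
qed

lemma measurable_coordinate: "t \<le> t0 \<Longrightarrow> (\<lambda>\<omega>. \<omega> t) \<in> borel_measurable paths.lim"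
  unfolding measurable_cong_sets[OF paths.sets_lim refl]
  by (rule measurable_component_singleton) simp

lemma distr_component_step:
  "finite J \<Longrightarrow> t \<in> J \<Longrightarrow> distr (PiM J (step_law J)) borel (\<lambda>x. x t) = step_law J t"
  using distr_PiM_component[of J "step_law J" t] prob_space_step[of J]
  by (simp add: sets_step cong: distr_cong)

lemma distr_increment:
  assumes "s \<le> t" "t \<le> t0"
  shows "distr paths.lim borel (\<lambda>\<omega>. \<omega> s - \<omega> t) = \<nu> t s"
proof (cases "s = t")
  case True
  then show ?thesis using assms by (simp add: same_time paths.P.distr_const)
next
  case False
  let ?J = "{s, t}"
  have st: "s < t" using False assms by simp
  have "distr paths.lim borel (\<lambda>\<omega>. restrict \<omega> ?J s - restrict \<omega> ?J t) =
      distr (PiM ?J (step_law ?J)) borel (\<lambda>x. path_sum ?J x s - path_sum ?J x t)"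
    by (rule distr_paths_finite[where g="\<lambda>x. x s - x t"]) (use assms in auto)
  also have "(\<lambda>x. path_sum ?J x s - path_sum ?J x t) = (\<lambda>x. x s)"
  proof
    fix x
    have "{u \<in> ?J. s \<le> u \<and> u < t0} = insert s {u \<in> ?J. t \<le> u \<and> u < t0}"
      "s \<notin> {u \<in> ?J. t \<le> u \<and> u < t0}" "finite {u \<in> ?J. t \<le> u \<and> u < t0}"
      using st assms by auto
    then show "path_sum ?J x s - path_sum ?J x t = x s"
      by (simp add: path_sum_def del: Collect_conj_eq)
  qed
  also have "distr (PiM ?J (step_law ?J)) borel (\<lambda>x. x s) = step_law ?J s"
    by (rule distr_component_step) auto
  also have "\<dots> = \<nu> t s"
  proof -
    have "insert t0 {u \<in> ?J. s < u} = {t0, t}" using st by auto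
    then show ?thesis using st assms by (simp add: step_law_def next_time_def min_def)
  qed
  finally show ?thesis by simp
qed

lemma AE_paths_start: "AE \<omega> in paths.lim. \<omega> t0 = 0"
proof -
  have "distr paths.lim borel (\<lambda>\<omega>. restrict \<omega> {t0} t0) =
      distr (PiM {t0} (step_law {t0})) borel (\<lambda>x. path_sum {t0} x t0)"
    by (rule distr_paths_finite[where g="\<lambda>x. x t0"]) auto
  also have "(\<lambda>x. path_sum {t0} x t0) = (\<lambda>x. 0)"
    by (auto simp: path_sum_def fun_eq_iff intro!: sum.neutral)
  also have "distr (PiM {t0} (step_law {t0})) borel (\<lambda>x. 0) = return borel 0"
    by (rule prob_space.distr_const) (auto intro!: prob_space_PiM prob_space_step)
  finally have "distr paths.lim borel (\<lambda>\<omega>. \<omega> t0) = return borel 0" by simp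
  then have "AE x in distr paths.lim borel (\<lambda>\<omega>. \<omega> t0). x = 0"
    by (simp only:) (simp add: AE_return)
  then show ?thesis by (subst (asm) AE_distr_iff) (auto intro: measurable_coordinate)
qed

lemma distr_coordinate:
  assumes t: "t \<le> t0"
  shows "distr paths.lim borel (\<lambda>\<omega>. \<omega> t) = \<nu> t0 t"
proof -
  note [measurable] = measurable_coordinate[OF t] measurable_coordinate[OF order_refl]
  have "distr paths.lim borel (\<lambda>\<omega>. \<omega> t) = distr paths.lim borel (\<lambda>\<omega>. \<omega> t - \<omega> t0)"
    using AE_paths_start by (intro distr_cong_AE) auto
  then show ?thesis using distr_increment[OF t order_refl] by simp
qed

text \<open>
  Relative to the finite set of all times involved, \<open>t0\<close> included, the increment into \<open>\<tau> j\<close> is the coordinate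
  \<open>\<tau> j\<close> of the product measure, and distinct coordinates are independent. The only exception is
  \<open>\<tau> 1 = t0\<close>, where the first increment is the constant zero, still a function of its
  coordinate; the functions \<open>g\<close> account for this case.
\<close>

lemma indep_increments:
  fixes \<tau> :: "nat \<Rightarrow> real"
  assumes n: "1 \<le> n" and start: "\<tau> 0 = t0" "\<tau> 1 \<le> t0" and dec: "\<forall>j\<in>{1..<n}. \<tau> (Suc j) < \<tau> j"
  shows "paths.P.indep_vars (\<lambda>_. borel) (\<lambda>j \<omega>. \<omega> (\<tau> j) - \<omega> (\<tau> (j - 1))) {1..n}"
proof -
  let ?I = "{1..n}"
  define J where "J = insert t0 (\<tau> ` ?I)"
  have mono: "\<tau> j < \<tau> i" if "1 \<le> i" "i < j" "j \<le> n" for i j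
    using that(2,3)
  proof (induction j)
    case (Suc j)
    then have "\<tau> (Suc j) < \<tau> j" using dec that(1) by auto
    then show ?case using Suc by (cases "i = j") auto
  qed simp
  have le_t0: "\<tau> j \<le> t0" if "j \<in> ?I" for j
    using that mono[of 1 j] start(2) by (cases "j = 1") auto
  have J: "finite J" "J \<subseteq> {..t0}" using le_t0 by (auto simp: J_def)
  have tau_J: "\<tau> j \<in> J" "\<tau> (j - 1) \<in> J" if "j \<in> ?I" for j
    using that start by (cases "j = 1"; force simp: J_def)+
  define g where "g j x = (if \<tau> j < t0 then x else 0)" for j and x :: 'a
  have incr: "path_sum J x (\<tau> j) - path_sum J x (\<tau> (j - 1)) = g j (x (\<tau> j))" if j: "j \<in> ?I" for j x
  proof -
    let ?A = "{u \<in> J. \<tau> (j - 1) \<le> u \<and> u < t0}"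
    have gap: "\<tau> (j - 1) \<le> u \<longleftrightarrow> \<tau> j \<le> u \<and> u \<noteq> \<tau> j" if u: "u \<in> J" "u < t0" for u
    proof -
      obtain i where i: "i \<in> ?I" "u = \<tau> i" using u by (auto simp: J_def)
      consider "i < j" | "i = j" | "i > j" by linarith
      then show ?thesis
      proof cases
        case 1
        then have "\<tau> (j - 1) \<le> u" "\<tau> j < u"
          using i j mono[of i "j - 1"] mono[of i j] by (cases "i = j - 1"; force)+
        then show ?thesis by simp
      next
        case 2
        have "u < \<tau> (j - 1)"
          using i j 2 mono[of "j - 1" j] u(2) start by (cases "j = 1") auto
        then show ?thesis using i 2 by simp
      next
        case 3
        then have "u < \<tau> j" "u < \<tau> (j - 1)"
          using i j mono[of j i] mono[of "j - 1" i] u(2) start by (cases "j = 1"; force)+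
        then show ?thesis by simp
      qed
    qed
    have "(\<Sum>u\<in>{u \<in> J. \<tau> j \<le> u \<and> u < t0}. x u) = g j (x (\<tau> j)) + (\<Sum>u\<in>?A. x u)"
    proof (cases "\<tau> j < t0")
      case True
      then have "{u \<in> J. \<tau> j \<le> u \<and> u < t0} = insert (\<tau> j) ?A"
        using gap tau_J(1)[OF j] by auto
      moreover have "\<tau> j \<notin> ?A" using gap[OF tau_J(1)[OF j]] by auto
      moreover have "finite ?A" using J by simp
      ultimately show ?thesis using True by (simp only: sum.insert g_def if_True simp_thms)
    next
      case False
      then have "{u \<in> J. \<tau> j \<le> u \<and> u < t0} = ?A" using gap by auto
      then show ?thesis using False by (simp add: g_def)
    qed
    then show ?thesis using tau_J[OF j] by (simp add: path_sum_def)
  qed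
  interpret Q: prob_space "PiM J (step_law J)" by (intro prob_space_PiM prob_space_step J)
  define Z where "Z j x = x (\<tau> j) - x (\<tau> (j - 1))" for j and x :: "real \<Rightarrow> 'a"
  have Z: "Z j \<in> borel_measurable (PiM J (\<lambda>_. borel))" if "j \<in> ?I" for j
    unfolding Z_def using tau_J[OF that] by measurable
  have I: "?I \<noteq> {}" using n by simp
  have "inj_on \<tau> ?I"
    by (rule linorder_inj_onI) (use mono in \<open>fastforce+\<close>)
  then have "Q.indep_vars (\<lambda>j. step_law J (\<tau> j)) (\<lambda>j x. x (\<tau> j)) ?I"
    using tau_J(1) J by (intro indep_vars_PiM_coordinates prob_space_step I) auto
  then have "Q.indep_vars (\<lambda>_. borel) (\<lambda>j x. g j (x (\<tau> j))) ?I"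
    by (rule Q.indep_vars_compose2)
      (simp add: g_def measurable_cong_sets[OF sets_step[OF J(1)] refl])
  then have "Q.indep_vars (\<lambda>_. borel) (\<lambda>j x. Z j (path_sum J x)) ?I"
    by (subst Q.indep_vars_cong[OF refl _ refl, where Y="\<lambda>j x. g j (x (\<tau> j))"])
      (simp_all only: Z_def incr)
  then have "prob_space.indep_vars (fdd J) (\<lambda>_. borel) Z ?I"
    unfolding fdd_def
    by (subst Q.indep_vars_distr_iff[OF I measurable_path_sum_step[OF J(1)] Z])
  then have "prob_space.indep_vars (distr paths.lim (PiM J (\<lambda>_. borel)) (\<lambda>\<omega>. restrict \<omega> J)) (\<lambda>_. borel) Z ?I"
    by (simp only: distr_restrict_paths[OF J])
  then have "paths.P.indep_vars (\<lambda>_. borel) (\<lambda>j \<omega>. Z j (restrict \<omega> J)) ?I"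
    by (subst (asm) paths.P.indep_vars_distr_iff[OF I measurable_restrict_paths[OF J(2)] Z])
  then show ?thesis
    by (subst paths.P.indep_vars_cong[OF refl _ refl, where Y="\<lambda>j \<omega>. Z j (restrict \<omega> J)"])
      (use tau_J in \<open>auto simp: Z_def\<close>)
qed

lemma measure_dist_coordinates:
  assumes "s \<le> t" "t \<le> t0"
  shows "measure paths.lim {\<omega> \<in> space paths.lim. dist (\<omega> s) (\<omega> t) > e} = measure (\<nu> t s) {x. norm x > e}"
proof -
  note [measurable] = measurable_coordinate[of s] measurable_coordinate[of t]
  have "measure (\<nu> t s) {x. norm x > e} = measure (distr paths.lim borel (\<lambda>\<omega>. \<omega> s - \<omega> t)) {x. norm x > e}"
    by (simp only: distr_increment[OF assms])
  also have "\<dots> = measure paths.lim ((\<lambda>\<omega>. \<omega> s - \<omega> t) -` {x. norm x > e} \<inter> space paths.lim)"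
    using assms by (intro measure_distr) auto
  also have "(\<lambda>\<omega>. \<omega> s - \<omega> t) -` {x. norm x > e} \<inter> space paths.lim =
      {\<omega> \<in> space paths.lim. dist (\<omega> s) (\<omega> t) > e}"
    by (auto simp: dist_norm)
  finally show ?thesis ..
qed

text \<open>
  An increment between \<open>t'\<close> and \<open>t\<close> has law \<open>\<nu>\<close> in whichever order the two times come, so the two one-sided
  tail conditions on \<open>\<nu>\<close> are the two one-sided limits in probability.
\<close>

lemma stochastically_continuous_paths:
  assumes left: "\<And>t e. t \<le> t0 \<Longrightarrow> e > 0 \<Longrightarrow> ((\<lambda>s. measure (\<nu> t s) {x. norm x > e}) \<longlongrightarrow> 0) (at_left t)"
    and right: "\<And>s e. s < t0 \<Longrightarrow> e > 0 \<Longrightarrow> ((\<lambda>t. measure (\<nu> t s) {x. norm x > e}) \<longlongrightarrow> 0) (at_right s)"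
  shows "stochastically_continuous_on paths.lim {..t0} (\<lambda>t \<omega>. \<omega> t)"
  unfolding stochastically_continuous_on_def
proof (intro ballI allI impI)
  fix t e :: real assume "t \<in> {..t0}" and e: "e > 0"
  then have t: "t \<le> t0" by simp
  let ?p = "\<lambda>t'. measure paths.lim {\<omega> \<in> space paths.lim. dist (\<omega> t') (\<omega> t) > e}"
  have "\<forall>\<^sub>F s in at_left t. ?p s = measure (\<nu> t s) {x. norm x > e}"
    unfolding eventually_at_filter
    using t by (intro always_eventually) (auto simp del: paths.space_lim intro!: measure_dist_coordinates)
  from tendsto_cong[OF this] have lim_left: "(?p \<longlongrightarrow> 0) (at_left t)"
    using left[OF t e] by (rule iffD2)
  have lim_right: "(?p \<longlongrightarrow> 0) (at t within {t<..t0})"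
  proof (cases "t = t0")
    case False
    then have "((\<lambda>r. measure (\<nu> r t) {x. norm x > e}) \<longlongrightarrow> 0) (at_right t)"
      using t e by (intro right) auto
    then have lim: "((\<lambda>r. measure (\<nu> r t) {x. norm x > e}) \<longlongrightarrow> 0) (at t within {t<..t0})"
      by (rule tendsto_within_subset) auto
    have "\<forall>\<^sub>F r in at t within {t<..t0}. ?p r = measure (\<nu> r t) {x. norm x > e}"
      unfolding eventually_at_filter
    proof (intro always_eventually allI impI)
      fix r assume "r \<in> {t<..t0}"
      then have "t \<le> r" "r \<le> t0" by auto
      then show "?p r = measure (\<nu> r t) {x. norm x > e}"
        by (subst dist_commute) (rule measure_dist_coordinates)
    qed
    from tendsto_cong[OF this] show ?thesis using lim by (rule iffD2)
  qed simp
  have "at t within {..t0} = at t within ({..<t} \<union> {t<..t0})"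
  proof -
    have "{..t0} - {t} = ({..<t} \<union> {t<..t0}) - {t}" using t by auto
    then show ?thesis by (simp only: at_within_def)
  qed
  also have "\<dots> = sup (at_left t) (at t within {t<..t0})" by (rule at_within_union)
  finally show "(?p \<longlongrightarrow> 0) (at t within {..t0})"
    using filterlim_sup[OF lim_left lim_right] by (simp only:)
qed

end

section \<open>Skew convolution equations\<close>

theorem theorem3p22:
  fixes U :: "real \<Rightarrow> real \<Rightarrow> 'a::{real_inner,polish_space} \<Rightarrow>\<^sub>L 'a"
    and t0 :: real
    and \<mu> :: "real \<Rightarrow> real \<Rightarrow> 'a measure"
  assumes evol: "evolution_family U"
    and prob: "\<And>s t. s \<le> t \<Longrightarrow> t \<le> t0 \<Longrightarrow> prob_space (\<mu> t s)"
    and sets: "\<And>s t. s \<le> t \<Longrightarrow> t \<le> t0 \<Longrightarrow> sets (\<mu> t s) = sets borel"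
    and skew: "\<And>s r t. s \<le> r \<Longrightarrow> r \<le> t \<Longrightarrow> t \<le> t0 \<Longrightarrow>
      \<mu> t s = conv_measure (\<mu> t r) (distr (\<mu> r s) borel (blinfun_apply (U t r)))"
    and left: "\<And>t. t \<le> t0 \<Longrightarrow> weak_conv_along (\<lambda>s. \<mu> t s) (return borel 0) (at_left t)"
    and right: "\<And>s. s < t0 \<Longrightarrow> weak_conv_along (\<lambda>t. \<mu> t s) (return borel 0) (at_right s)"
  shows
    "((\<forall>s r t. s \<le> r \<longrightarrow> r \<le> t \<longrightarrow> t \<le> t0 \<longrightarrow>
          tilde_measure U t0 \<mu> t s =
            conv_measure (tilde_measure U t0 \<mu> t r) (tilde_measure U t0 \<mu> r s)) \<and>
      (\<forall>s\<le>t0. tilde_measure U t0 \<mu> s s = return borel 0) \<and>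
      (\<forall>t\<le>t0. weak_conv_along (\<lambda>s. tilde_measure U t0 \<mu> t s) (return borel 0) (at_left t)) \<and>
      (\<forall>s<t0. weak_conv_along (\<lambda>t. tilde_measure U t0 \<mu> t s) (return borel 0) (at_right s)))
     \<and>
     (\<exists>(M :: (real \<Rightarrow> 'a) measure) (X :: real \<Rightarrow> (real \<Rightarrow> 'a) \<Rightarrow> 'a).
        prob_space M \<and>
        (\<forall>t\<le>t0. X t \<in> borel_measurable M) \<and>
        stochastically_continuous_on M {..t0} X \<and>
        (\<forall>t\<le>t0. distr M borel (X t) = \<mu> t0 t) \<and>
        (AE \<omega> in M. X t0 \<omega> = 0) \<and>
        (\<forall>(n::nat) (\<tau> :: nat \<Rightarrow> real).
           1 \<le> n \<longrightarrow> \<tau> 0 = t0 \<longrightarrow> \<tau> 1 \<le> t0 \<longrightarrow> (\<forall>j\<in>{1..<n}. \<tau> (Suc j) < \<tau> j) \<longrightarrow>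
           prob_space.indep_vars M (\<lambda>_. borel)
             (\<lambda>j \<omega>. X (\<tau> j) \<omega> - X (\<tau> (j - 1)) \<omega>) {1..n}) \<and>
        (\<forall>s t. s \<le> t \<longrightarrow> t \<le> t0 \<longrightarrow>
           distr M borel (\<lambda>\<omega>. X s \<omega> - X t \<omega>) = tilde_measure U t0 \<mu> t s))"
proof -
  let ?\<nu> = "tilde_measure U t0 \<mu>"
  have id: "U s s = id_blinfun" for s
    using evol by (simp add: evolution_family_def)
  have comp: "U t r o\<^sub>L U r s = U t s" if "s \<le> r" "r \<le> t" for s r t
    using evol that by (simp add: evolution_family_def)
  have prob_\<nu>: "prob_space (?\<nu> t s)" if "s \<le> t" "t \<le> t0" for s t
    unfolding tilde_measure_def
    using prob[OF that] by (rule prob_space.prob_space_distr) (simp add: measurable_cong_sets[OF sets[OF that] refl])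
  have sets_\<nu>: "sets (?\<nu> t s) = sets borel" for s t
    by (simp add: tilde_measure_def)

  have ev_left: "\<forall>\<^sub>F s in at_left t. s \<le> t" for t :: real
    unfolding eventually_at_filter by (intro always_eventually) auto
  have ev_right: "\<forall>\<^sub>F t in at_right s. s \<le> t \<and> t \<le> t0" if "s < t0" for s
    using eventually_at_right_real[OF that] by (rule eventually_mono) auto

  have tails_left: "((\<lambda>s. measure (\<mu> t s) {x. norm x > e}) \<longlongrightarrow> 0) (at_left t)"
    if t: "t \<le> t0" and e: "e > 0" for t e
  proof -
    have "\<forall>\<^sub>F s in at_left t. prob_space (\<mu> t s) \<and> sets (\<mu> t s) = sets borel"
      using ev_left by (rule eventually_mono) (use prob sets t in blast)
    from weak_conv_along_return_0_iff_tails[OF this] show ?thesis using left[OF t] e by blast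
  qed
  have tails_right: "((\<lambda>t. measure (\<mu> t s) {x. norm x > e}) \<longlongrightarrow> 0) (at_right s)"
    if s: "s < t0" and e: "e > 0" for s e
  proof -
    have "\<forall>\<^sub>F t in at_right s. prob_space (\<mu> t s) \<and> sets (\<mu> t s) = sets borel"
      using ev_right[OF s] by (rule eventually_mono) (use prob sets in blast)
    from weak_conv_along_return_0_iff_tails[OF this] show ?thesis using right[OF s] e by blast
  qed

  have tails_\<nu>: "measure (?\<nu> t s) {x. norm x > e} \<le> measure (\<mu> t s) {x. norm x > e / C}"
    if st: "s \<le> t" "t \<le> t0" and C: "C > 0" "norm (U t0 t) \<le> C" for s t e C
  proof -
    interpret prob_space "\<mu> t s" by (rule prob[OF st])
    have "measure (?\<nu> t s) {x. norm x > e} = measure (\<mu> t s) (blinfun_apply (U t0 t) -` {x. norm x > e} \<inter> space (\<mu> t s))"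
      unfolding tilde_measure_def
      by (rule measure_distr) (simp_all add: measurable_cong_sets[OF sets[OF st] refl])
    also have "\<dots> \<le> measure (\<mu> t s) {x. norm x > e / C}"
    proof (rule finite_measure_mono)
      show "blinfun_apply (U t0 t) -` {x. norm x > e} \<inter> space (\<mu> t s) \<subseteq> {x. norm x > e / C}"
      proof
        fix x assume "x \<in> blinfun_apply (U t0 t) -` {x. norm x > e} \<inter> space (\<mu> t s)"
        then have "e < norm (U t0 t x)" by simp
        also have "\<dots> \<le> C * norm x"
          using norm_blinfun[of "U t0 t" x] C(2) by (meson mult_right_mono norm_ge_zero order_trans)
        finally show "x \<in> {x. norm x > e / C}" using C(1) by (simp add: field_simps)
      qed
    qed (simp add: sets[OF st])
    finally show ?thesis .
  qed

  \<comment> \<open>Since \<open>\<mu> t s\<close> is \<open>\<mu> t t * \<mu> t s\<close> and both it and the second factor tend to \<open>\<delta>\<close> at 0, so does the first.\<close>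
  have diagonal: "\<mu> t t = return borel 0" if t: "t \<le> t0" for t
  proof (rule eq_return_0_if_tails_0)
    fix e :: real assume e: "e > 0"
    have lim: "((\<lambda>s. measure (\<mu> t s) {x. norm x > e / 2}) \<longlongrightarrow> 0) (at_left t)"
      using tails_left[OF t, of "e / 2"] e by simp
    have "\<forall>\<^sub>F s in at_left t. measure (\<mu> t t) {x. norm x > e} \<le> 2 * measure (\<mu> t s) {x. norm x > e / 2}"
      using ev_left
    proof (rule eventually_mono)
      fix s assume st: "s \<le> t"
      have "distr (\<mu> t s) borel (blinfun_apply (U t t)) = \<mu> t s"
        using distr_id2[of borel "\<mu> t s"] sets[OF st t] by (simp add: id id_def)
      then have "\<mu> t s = conv_measure (\<mu> t t) (\<mu> t s)"
        using skew[OF st order_refl t] by simp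
      then show "measure (\<mu> t t) {x. norm x > e} \<le> 2 * measure (\<mu> t s) {x. norm x > e / 2}"
        using tail_le_conv_measure[of "\<mu> t t" "\<mu> t s" "e / 2"] prob sets st t by simp
    qed
    then have "measure (\<mu> t t) {x. norm x > e} \<le> 2 * 0"
      by (intro tendsto_lowerbound[OF tendsto_mult_left[OF lim, of 2]]) auto
    then show "measure (\<mu> t t) {x. norm x > e} = 0" by (simp add: measure_le_0_iff)
  qed (use prob sets t in auto)

  interpret H: convolution_hemigroup t0 ?\<nu>
  proof (rule convolution_hemigroup.intro)
    show "?\<nu> t s = conv_measure (?\<nu> t r) (?\<nu> r s)" if "s \<le> r" "r \<le> t" "t \<le> t0" for s r t
    proof -
      have r: "r \<le> t0" and st: "s \<le> t" using that by auto
      have meas: "blinfun_apply L \<in> \<mu> r s \<rightarrow>\<^sub>M borel" for L :: "'a \<Rightarrow>\<^sub>L 'a"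
        by (simp add: measurable_cong_sets[OF sets[OF that(1) r] refl])
      have "?\<nu> t s = distr (conv_measure (\<mu> t r) (distr (\<mu> r s) borel (blinfun_apply (U t r)))) borel (blinfun_apply (U t0 t))"
        unfolding tilde_measure_def by (subst skew[OF that]) (rule refl)
      also have "\<dots> = conv_measure (?\<nu> t r) (distr (distr (\<mu> r s) borel (blinfun_apply (U t r))) borel (blinfun_apply (U t0 t)))"
        unfolding tilde_measure_def
        using prob[OF that(1) r] meas
        by (intro distr_conv_measure prob sets that r prob_space.prob_space_distr sets_distr)
      also have "distr (distr (\<mu> r s) borel (blinfun_apply (U t r))) borel (blinfun_apply (U t0 t)) = ?\<nu> r s"
        unfolding tilde_measure_def comp[OF that(2,3), symmetric]
        by (subst distr_distr) (auto simp: meas comp_def intro!: distr_cong)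
      finally show ?thesis .
    qed
    show "?\<nu> s s = return borel 0" if "s \<le> t0" for s
      using that by (simp add: tilde_measure_def diagonal distr_return)
  qed (simp_all add: prob_\<nu> sets_\<nu>)

  have left_tails: "((\<lambda>s. measure (?\<nu> t s) {x. norm x > e}) \<longlongrightarrow> 0) (at_left t)"
    if t: "t \<le> t0" and e: "e > 0" for t e
  proof -
    define C where "C = norm (U t0 t) + 1"
    have C: "C > 0" "norm (U t0 t) \<le> C" by (auto simp: C_def add_nonneg_pos)
    show ?thesis
    proof (rule tendsto_sandwich[OF _ _ tendsto_const])
      show "((\<lambda>s. measure (\<mu> t s) {x. norm x > e / C}) \<longlongrightarrow> 0) (at_left t)"
        using tails_left[OF t, of "e / C"] e C(1) by simp
      show "\<forall>\<^sub>F s in at_left t. measure (?\<nu> t s) {x. norm x > e} \<le> measure (\<mu> t s) {x. norm x > e / C}"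
        using ev_left by (rule eventually_mono) (rule tails_\<nu>[OF _ t C])
    qed simp
  qed

  \<comment> \<open>Here the operator \<open>U t0 t\<close> moves with \<open>t\<close>: strong continuity bounds each orbit on \<open>{s..t0}\<close>,
    and uniform boundedness turns this into one constant for all \<open>t\<close>.\<close>
  have right_tails: "((\<lambda>t. measure (?\<nu> t s) {x. norm x > e}) \<longlongrightarrow> 0) (at_right s)"
    if s: "s < t0" and e: "e > 0" for s e
  proof -
    have "\<exists>C. \<forall>t\<in>{s..t0}. norm (U t0 t) \<le> C"
    proof (rule uniform_boundedness)
      fix x
      have "continuous_on {(t, s). s \<le> t} (\<lambda>(t, s). U t s x)"
        using evol by (simp add: evolution_family_def)
      then have "continuous_on {s..t0} ((\<lambda>(t, s). U t s x) \<circ> (\<lambda>t. (t0, t)))"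
        by (intro continuous_on_compose continuous_intros) (auto elim: continuous_on_subset)
      then have "compact ((\<lambda>t. U t0 t x) ` {s..t0})"
        by (intro compact_continuous_image) (auto simp: comp_def)
      then show "\<exists>C. \<forall>t\<in>{s..t0}. norm (U t0 t x) \<le> C"
        by (meson bounded_iff compact_imp_bounded imageI)
    qed
    then obtain C' where C': "\<And>t. t \<in> {s..t0} \<Longrightarrow> norm (U t0 t) \<le> C'" by blast
    define C where "C = max C' 1"
    have C: "C > 0" "\<And>t. s \<le> t \<Longrightarrow> t \<le> t0 \<Longrightarrow> norm (U t0 t) \<le> C"
      using C' by (auto simp: C_def le_max_iff_disj)
    show ?thesis
    proof (rule tendsto_sandwich[OF _ _ tendsto_const])
      show "((\<lambda>t. measure (\<mu> t s) {x. norm x > e / C}) \<longlongrightarrow> 0) (at_right s)"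
        using tails_right[OF s, of "e / C"] e C(1) by simp
      show "\<forall>\<^sub>F t in at_right s. measure (?\<nu> t s) {x. norm x > e} \<le> measure (\<mu> t s) {x. norm x > e / C}"
        using ev_right[OF s] by (rule eventually_mono) (use tails_\<nu> C in blast)
    qed simp
  qed

  have weak_left: "weak_conv_along (\<lambda>s. ?\<nu> t s) (return borel 0) (at_left t)" if t: "t \<le> t0" for t
  proof (subst weak_conv_along_return_0_iff_tails)
    show "\<forall>\<^sub>F s in at_left t. prob_space (?\<nu> t s) \<and> sets (?\<nu> t s) = sets borel"
      using ev_left by (rule eventually_mono) (use t in \<open>auto simp: sets_\<nu> intro: prob_\<nu>\<close>)
  qed (use left_tails t in blast)

  have weak_right: "weak_conv_along (\<lambda>t. ?\<nu> t s) (return borel 0) (at_right s)" if s: "s < t0" for s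
  proof (subst weak_conv_along_return_0_iff_tails)
    show "\<forall>\<^sub>F t in at_right s. prob_space (?\<nu> t s) \<and> sets (?\<nu> t s) = sets borel"
      using ev_right[OF s] by (rule eventually_mono) (auto simp: sets_\<nu> intro: prob_\<nu>)
  qed (use right_tails s in blast)

  have top: "?\<nu> t0 t = \<mu> t0 t" if "t \<le> t0" for t
    using distr_id2[OF sets[OF that order_refl, symmetric]] by (simp add: tilde_measure_def id id_def)

  show ?thesis
  proof (rule conjI)
    show "\<exists>(M :: (real \<Rightarrow> 'a) measure) (X :: real \<Rightarrow> (real \<Rightarrow> 'a) \<Rightarrow> 'a).
        prob_space M \<and>
        (\<forall>t\<le>t0. X t \<in> borel_measurable M) \<and>
        stochastically_continuous_on M {..t0} X \<and>
        (\<forall>t\<le>t0. distr M borel (X t) = \<mu> t0 t) \<and>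
        (AE \<omega> in M. X t0 \<omega> = 0) \<and>
        (\<forall>(n::nat) (\<tau> :: nat \<Rightarrow> real).
           1 \<le> n \<longrightarrow> \<tau> 0 = t0 \<longrightarrow> \<tau> 1 \<le> t0 \<longrightarrow> (\<forall>j\<in>{1..<n}. \<tau> (Suc j) < \<tau> j) \<longrightarrow>
           prob_space.indep_vars M (\<lambda>_. borel)
             (\<lambda>j \<omega>. X (\<tau> j) \<omega> - X (\<tau> (j - 1)) \<omega>) {1..n}) \<and>
        (\<forall>s t. s \<le> t \<longrightarrow> t \<le> t0 \<longrightarrow>
           distr M borel (\<lambda>\<omega>. X s \<omega> - X t \<omega>) = ?\<nu> t s)"
    proof (rule exI[of _ H.paths.lim], rule exI[of _ "\<lambda>t \<omega>. \<omega> t"], intro conjI allI impI)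
      show "prob_space H.paths.lim" by (rule H.paths.P.prob_space_axioms)
      show "stochastically_continuous_on H.paths.lim {..t0} (\<lambda>t \<omega>. \<omega> t)"
        by (rule H.stochastically_continuous_paths) (rule left_tails right_tails; assumption)+
      show "distr H.paths.lim borel (\<lambda>\<omega>. \<omega> t) = \<mu> t0 t" if "t \<le> t0" for t
        using H.distr_coordinate[OF that] top[OF that] by simp
    qed (intro H.measurable_coordinate H.AE_paths_start H.indep_increments H.distr_increment; assumption)+
  qed (intro conjI allI impI H.conv H.same_time weak_left weak_right; assumption)
qed

end
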